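(* Let $X$ be a complex Banach space and let $T\in\mathcal{B}(X)$ be a pseudo Fredholm operator. Then there exists $S\in\mathcal{B}(X)$ such that $T+S$ is semi-regular, $TS$ is quasi-nilpotent and $[T,S]=0$.
   Context: $\mathcal{B}(X)$ is the algebra of bounded linear operators on $X$, and $[T,S]=TS-ST$ is the commutator. An operator $T$ is semi-regular if its range $R(T)$ is closed and its kernel satisfies $N(T)\subseteq R^{\infty}(T)=\bigcap_{n\ge 0}R(T^n)$. $T$ is pseudo Fredholm (i.e. admits a generalized Kato decomposition) if there are closed $T$-invariant subspaces $X_1,X_2$ with $X=X_1\oplus X_2$ such that $T_{|X_1}$ is semi-regular and $T_{|X_2}$ is quasi-nilpotent. *)

theory Defs
  imports "HOL-Analysis.Analysis"
begin

text \<open>A complex Banach space: the underlying real Banach space together with a complex scalar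
  multiplication that extends the real one and for which the norm is homogeneous.\<close>

class complex_banach = banach +
  fixes scaleC :: "complex \<Rightarrow> 'a \<Rightarrow> 'a"  (infixr "*\<^sub>C" 75)
  assumes scaleC_add_right: "c *\<^sub>C (x + y) = c *\<^sub>C x + c *\<^sub>C y"
    and scaleC_add_left: "(c + d) *\<^sub>C x = c *\<^sub>C x + d *\<^sub>C x"
    and scaleC_scaleC: "c *\<^sub>C d *\<^sub>C x = (c * d) *\<^sub>C x"
    and scaleC_of_real: "complex_of_real r *\<^sub>C x = r *\<^sub>R x"
    and norm_scaleC: "norm (c *\<^sub>C x) = cmod c * norm x"

global_interpretation complex_vector:
  vector_space "scaleC :: complex \<Rightarrow> 'a::complex_banach \<Rightarrow> 'a"
  by standard
    (simp_all add: scaleC_add_right scaleC_add_left scaleC_scaleC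
      scaleC_of_real [of 1, simplified])

text \<open>The algebra of bounded complex-linear operators, as a set of functions.\<close>

definition bounded_operators :: "('a::complex_banach \<Rightarrow> 'a) set"  ("\<B>")
  where "\<B> = {T. Vector_Spaces.linear scaleC scaleC T \<and> bounded_linear T}"

definition commutator :: "('a::complex_banach \<Rightarrow> 'a) \<Rightarrow> ('a \<Rightarrow> 'a) \<Rightarrow> 'a \<Rightarrow> 'a"
  where "commutator T S = (\<lambda>x. T (S x) - S (T x))"

definition closed_csubspace :: "'a::complex_banach set \<Rightarrow> bool"
  where "closed_csubspace M \<longleftrightarrow> complex_vector.subspace M \<and> closed M"

text \<open>The predicates suffixed \<open>_on\<close> describe the restriction of \<open>T\<close> to a closed \<open>T\<close>-invariant
  subspace \<open>M\<close>. Since \<open>M\<close> is closed, it does not matter whether the range of the restriction is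
  required to be closed in \<open>M\<close> or in the whole space.\<close>

definition semi_regular_on :: "'a::complex_banach set \<Rightarrow> ('a \<Rightarrow> 'a) \<Rightarrow> bool"
  where "semi_regular_on M T \<longleftrightarrow>
    closed (T ` M) \<and> {x \<in> M. T x = 0} \<subseteq> (\<Inter>n. (T ^^ n) ` M)"

abbreviation semi_regular :: "('a::complex_banach \<Rightarrow> 'a) \<Rightarrow> bool"
  where "semi_regular \<equiv> semi_regular_on UNIV"

text \<open>Operator norm of the restriction to \<open>M\<close>; for \<open>M = UNIV\<close> this is \<^const>\<open>onorm\<close>. The point
  \<open>0\<close> contributes the value \<open>0\<close> to the supremum, so the norm on the zero space is \<open>0\<close>.\<close>

definition onorm_on :: "'a::complex_banach set \<Rightarrow> ('a \<Rightarrow> 'a) \<Rightarrow> real"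
  where "onorm_on M T = (SUP x\<in>M. norm (T x) / norm x)"

text \<open>Quasi-nilpotency: the spectral radius \<open>lim \<parallel>T\<^sup>n\<parallel>\<^sup>1\<^sup>/\<^sup>n\<close> is zero. Operators on the zero space are
  quasi-nilpotent. (\<^term>\<open>root 0 r = 0\<close>, so the index \<open>0\<close> is harmless.)\<close>

definition quasi_nilpotent_on :: "'a::complex_banach set \<Rightarrow> ('a \<Rightarrow> 'a) \<Rightarrow> bool"
  where "quasi_nilpotent_on M T \<longleftrightarrow> (\<lambda>n. root n (onorm_on M (T ^^ n))) \<longlonglongrightarrow> 0"

abbreviation quasi_nilpotent :: "('a::complex_banach \<Rightarrow> 'a) \<Rightarrow> bool"
  where "quasi_nilpotent \<equiv> quasi_nilpotent_on UNIV"

definition pseudo_fredholm :: "('a::complex_banach \<Rightarrow> 'a) \<Rightarrow> bool"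
  where "pseudo_fredholm T \<longleftrightarrow> (\<exists>X1 X2.
    closed_csubspace X1 \<and> T ` X1 \<subseteq> X1 \<and>
    closed_csubspace X2 \<and> T ` X2 \<subseteq> X2 \<and>
    {x + y | x y. x \<in> X1 \<and> y \<in> X2} = UNIV \<and> X1 \<inter> X2 = {0} \<and>
    semi_regular_on X1 T \<and> quasi_nilpotent_on X2 T)"

end

theory Submission
  imports Defs
begin

text \<open>
  Let \<open>X = X\<^sub>1 \<oplus> X\<^sub>2\<close> be a generalized Kato decomposition for \<open>T\<close>. The operator \<open>S\<close> is the
  projection \<open>P\<close> onto \<open>X\<^sub>2\<close> along \<open>X\<^sub>1\<close>. It commutes with \<open>T\<close> because both summands are
  invariant, and \<open>(T P)\<^sup>n = T\<^sup>n P\<close> for \<open>n > 0\<close>, so the quasi-nilpotency of \<open>T\<close> on \<open>X\<^sub>2\<close> passes to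
  \<open>T P\<close>. On \<open>X\<^sub>1\<close> the operator \<open>T + P\<close> is the semi-regular \<open>T\<close>; on \<open>X\<^sub>2\<close> it is \<open>T + I\<close>, which is
  bijective there by a Neumann series. Hence \<open>T + P\<close> has the same kernel as \<open>T\<close> restricted to
  \<open>X\<^sub>1\<close>, and this kernel lies in \<open>T\<^sup>n(X\<^sub>1) = (T + P)\<^sup>n(X\<^sub>1)\<close> for all \<open>n\<close>. The range of \<open>T + P\<close>
  consists of the vectors whose \<open>X\<^sub>1\<close>-component lies in the closed set \<open>T(X\<^sub>1)\<close>; it is closed since \<open>P\<close> is continuous.

  The analytic input is this continuity, an instance of the closed graph theorem
  (\<open>closed_graph_imp_bounded_linear\<close>). That theorem is derived from the Baire category theorem:
  some set \<open>{x. \<parallel>P x\<parallel> \<le> n}\<close> is dense near a point, which gives approximate solutions with bounded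
  image under \<open>P\<close>, and these are summed to exact ones.
\<close>

section \<open>The closed graph theorem\<close>

text \<open>
  The sublevel sets \<open>{x. \<parallel>f x\<parallel> \<le> n}\<close> cover the space, so by Baire the closure of one of them contains
  a ball. The sublevel sets are convex and symmetric, so the ball can be moved to the origin,
  and scaling turns this into an approximation statement with relative error one half.
\<close>

lemma linear_approximation_with_bounded_image:
  fixes f :: "'a::banach \<Rightarrow> 'b::real_normed_vector"
  assumes "linear f"
  obtains K where "0 \<le> K"
    "\<And>x. \<exists>w. norm (x - w) \<le> norm x / 2 \<and> norm (f w) \<le> K * norm x"
proof -
  interpret linear f by fact
  define C where "C n = {x. norm (f x) \<le> real n}" for n
  have "\<exists>n. interior (closure (C n)) \<noteq> {}"
  proof (rule ccontr)
    assume "\<not> ?thesis"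
    then have "interior (\<Union>n. closure (C n)) = {}"
      using Met_TC.metric_Baire_category_alt[of "range (\<lambda>n. closure (C n))"]
      by (auto simp: complete_UNIV)
    moreover have "(\<Union>n. closure (C n)) = UNIV"
    proof -
      have "x \<in> closure (C (nat \<lceil>norm (f x)\<rceil>))" for x
        by (rule subsetD[OF closure_subset]) (simp add: C_def real_nat_ceiling_ge)
      then show ?thesis by blast
    qed
    ultimately show False by simp
  qed
  then obtain n a where "a \<in> interior (closure (C n))" by blast
  then obtain e where e: "0 < e" "ball a e \<subseteq> closure (C n)"
    by (auto simp: mem_interior)
  have near0: "\<exists>w. norm (z - w) < d \<and> norm (f w) \<le> real n" if "norm z < e" "0 < d" for z d
  proof -
    have "a + z \<in> closure (C n)" "a - z \<in> closure (C n)"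
      using e that by (auto simp: dist_norm subset_iff)
    then obtain u v where u: "u \<in> C n" "dist u (a + z) < d" and v: "v \<in> C n" "dist v (a - z) < d"
      using \<open>0 < d\<close> by (meson closure_approachable)
    define w where "w = (1/2) *\<^sub>R (u - v)"
    have "z - w = (1/2) *\<^sub>R (((a + z) - u) - ((a - z) - v))"
      unfolding w_def by (simp add: scaleR_diff_right scaleR_add_right flip: scaleR_add_left)
    then have "norm (z - w) \<le> (norm ((a + z) - u) + norm ((a - z) - v)) / 2"
      using norm_triangle_ineq4[of "(a + z) - u" "(a - z) - v"] by simp
    then have 1: "norm (z - w) < d"
      using u v by (simp add: dist_norm norm_minus_commute)
    have "norm (f w) \<le> (norm (f u) + norm (f v)) / 2"
      using norm_triangle_ineq4[of "f u" "f v"] by (simp add: w_def scale diff)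
    then have "norm (f w) \<le> real n"
      using u v by (simp add: C_def)
    with 1 show ?thesis by blast
  qed
  show thesis
  proof
    show "0 \<le> 2 * real n / e" using e by simp
    fix x
    show "\<exists>w. norm (x - w) \<le> norm x / 2 \<and> norm (f w) \<le> 2 * real n / e * norm x"
    proof (cases "x = 0")
      case True
      then show ?thesis by (intro exI[of _ 0]) (simp add: zero)
    next
      case False
      define t where "t = e / (2 * norm x)"
      have t: "0 < t" "t * norm x = e / 2" using e False by (auto simp: t_def)
      obtain w where w: "norm (t *\<^sub>R x - w) < e / 4" "norm (f w) \<le> real n"
        using near0[of "t *\<^sub>R x" "e / 4"] t e by auto
      have "x = (t *\<^sub>R x) /\<^sub>R t" using t(1) by simp
      then have "x - w /\<^sub>R t = (t *\<^sub>R x - w) /\<^sub>R t" by (metis scaleR_diff_right)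
      also have "norm \<dots> = norm (t *\<^sub>R x - w) / t"
        using t(1) unfolding norm_scaleR by (simp add: divide_inverse)
      also have "\<dots> \<le> (e / 4) / t" using w t(1) by (intro divide_right_mono) auto
      also have "\<dots> = norm x / 2" using e False by (simp add: t_def)
      finally have 1: "norm (x - w /\<^sub>R t) \<le> norm x / 2" .
      have "norm (f (w /\<^sub>R t)) = norm (f w) / t"
        using t(1) unfolding scale norm_scaleR by (simp add: divide_inverse)
      also have "\<dots> \<le> real n / t" using w t(1) by (intro divide_right_mono) auto
      also have "\<dots> = 2 * real n / e * norm x" using e False by (simp add: t_def)
      finally show ?thesis using 1 by blast
    qed
  qed
qed

text \<open>
  Iterating the approximation on the residual writes \<open>x\<close> as a series \<open>\<Sum>w\<^sub>k\<close> for which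
  \<open>\<Sum>f w\<^sub>k\<close> converges absolutely with a bound proportional to \<open>\<parallel>x\<parallel>\<close>; closedness of the graph
  identifies the latter sum with \<open>f x\<close>.
\<close>

theorem closed_graph_imp_bounded_linear:
  fixes f :: "'a::banach \<Rightarrow> 'b::banach"
  assumes "linear f"
    and closed_graph: "\<And>X x y. X \<longlonglongrightarrow> x \<Longrightarrow> (\<lambda>n. f (X n)) \<longlonglongrightarrow> y \<Longrightarrow> f x = y"
  shows "bounded_linear f"
proof -
  interpret linear f by fact
  obtain K where K: "0 \<le> K"
    and ex: "\<And>x. \<exists>w. norm (x - w) \<le> norm x / 2 \<and> norm (f w) \<le> K * norm x"
    using linear_approximation_with_bounded_image[OF \<open>linear f\<close>] by metis
  obtain w where w: "\<And>x. norm (x - w x) \<le> norm x / 2" "\<And>x. norm (f (w x)) \<le> K * norm x"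
    using ex by metis
  show ?thesis
  proof (rule bounded_linear_intro[where K = "2 * K"])
    fix x
    define r where "r k = ((\<lambda>y. y - w y) ^^ k) x" for k
    have r_Suc: "r (Suc k) = r k - w (r k)" for k by (simp add: r_def)
    have norm_r: "norm (r k) \<le> (1/2) ^ k * norm x" for k
    proof (induction k)
      case 0
      then show ?case by (simp add: r_def)
    next
      case (Suc k)
      then show ?case using w(1)[of "r k"] by (simp add: r_Suc)
    qed
    have norm_f: "norm (f (w (r k))) \<le> (1/2) ^ k * (K * norm x)" for k
      using order_trans[OF w(2) mult_left_mono[OF norm_r K]] by (simp add: ac_simps)
    have geom: "(\<lambda>k. (1/2) ^ k * (K * norm x)) sums (2 * (K * norm x))"
      using sums_mult2[OF geometric_sums[of "1/2::real"], of "K * norm x"] by simp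
    have "summable (\<lambda>k. norm (f (w (r k))))"
      by (rule summable_comparison_test'[OF sums_summable[OF geom]]) (simp add: norm_f)
    then have summ: "summable (\<lambda>k. f (w (r k)))" by (rule summable_norm_cancel)
    have "r \<longlonglongrightarrow> 0"
    proof (rule Lim_null_comparison)
      show "\<forall>\<^sub>F k in sequentially. norm (r k) \<le> (1/2) ^ k * norm x" by (simp add: norm_r)
      show "(\<lambda>k. (1/2) ^ k * norm x) \<longlonglongrightarrow> 0"
        by (intro tendsto_mult_left_zero LIMSEQ_power_zero) simp
    qed
    then have "(\<lambda>k. x - r k) \<longlonglongrightarrow> x" using tendsto_diff[OF tendsto_const[of x]] by fastforce
    moreover have "f (x - r k) = (\<Sum>i<k. f (w (r i)))" for k
      by (induction k) (simp_all add: r_Suc r_def[of 0] diff zero add algebra_simps)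
    then have "(\<lambda>k. f (x - r k)) \<longlonglongrightarrow> (\<Sum>k. f (w (r k)))"
      using summable_LIMSEQ[OF summ] by simp
    ultimately have "f x = (\<Sum>k. f (w (r k)))" by (rule closed_graph)
    also have "norm \<dots> \<le> (\<Sum>k. (1/2) ^ k * (K * norm x))"
      by (rule norm_suminf_le[OF norm_f sums_summable[OF geom]])
    also have "\<dots> = norm x * (2 * K)" by (simp add: sums_unique[OF geom, symmetric])
    finally show "norm (f x) \<le> norm x * (2 * K)" .
  qed (simp_all add: add scale)
qed

section \<open>The projection of a topological direct sum\<close>

text \<open>
  The graph of the algebraic projection is cut out by the two conditions \<open>y \<in> X2\<close> and
  \<open>x - y \<in> X1\<close>, which are closed conditions.
\<close>

lemma direct_sum_projection:
  fixes X1 X2 :: "'a::complex_banach set"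
  assumes "closed_csubspace X1" "closed_csubspace X2"
    and sum: "{x + y | x y. x \<in> X1 \<and> y \<in> X2} = UNIV" and int: "X1 \<inter> X2 = {0}"
  obtains P where "P \<in> \<B>" "\<And>x y. P x = y \<longleftrightarrow> y \<in> X2 \<and> x - y \<in> X1"
proof -
  have sub: "complex_vector.subspace X1" "complex_vector.subspace X2"
    and cl: "closed X1" "closed X2"
    using assms by (auto simp: closed_csubspace_def)
  have "\<exists>y. y \<in> X2 \<and> x - y \<in> X1" for x
  proof -
    from sum have "x \<in> {x + y | x y. x \<in> X1 \<and> y \<in> X2}" by simp
    then show ?thesis by force
  qed
  then obtain P where P: "\<And>x. P x \<in> X2" "\<And>x. x - P x \<in> X1" by metis
  have P_eq: "P x = y \<longleftrightarrow> y \<in> X2 \<and> x - y \<in> X1" for x y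
  proof
    assume y: "y \<in> X2 \<and> x - y \<in> X1"
    have "(x - y) - (x - P x) \<in> X1" "P x - y \<in> X2"
      using complex_vector.subspace_diff[OF sub(1)] complex_vector.subspace_diff[OF sub(2)] y P
      by blast+
    then have "P x - y \<in> X1 \<inter> X2" by simp
    then show "P x = y" by (simp add: int)
  qed (use P in auto)
  have P_add: "P (x + y) = P x + P y" for x y
    unfolding P_eq
    using complex_vector.subspace_add[OF sub(2) P(1)[of x] P(1)[of y]]
      complex_vector.subspace_add[OF sub(1) P(2)[of x] P(2)[of y]]
    by (simp add: algebra_simps)
  have P_scaleC: "P (c *\<^sub>C x) = c *\<^sub>C P x" for c x
    unfolding P_eq
    using complex_vector.subspace_scale[OF sub(2) P(1)[of x]]
      complex_vector.subspace_scale[OF sub(1) P(2)[of x]]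
    by (simp flip: complex_vector.scale_right_diff_distrib)
  have "linear P"
    by (rule linearI) (simp_all add: P_add P_scaleC flip: scaleC_of_real)
  then have "bounded_linear P"
  proof (rule closed_graph_imp_bounded_linear)
    fix X x y
    assume lim: "X \<longlonglongrightarrow> x" "(\<lambda>n. P (X n)) \<longlonglongrightarrow> y"
    have "y \<in> X2" using closed_sequentially[OF cl(2) _ lim(2)] P by blast
    moreover have "x - y \<in> X1"
      using closed_sequentially[OF cl(1) _ tendsto_diff[OF lim]] P by blast
    ultimately show "P x = y" by (simp add: P_eq)
  qed
  moreover have "Vector_Spaces.linear scaleC scaleC P"
    by (simp add: Vector_Spaces.linear_iff complex_vector.vector_space_axioms P_add P_scaleC)
  ultimately have "P \<in> \<B>" by (simp add: bounded_operators_def)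
  then show thesis using P_eq by (rule that)
qed

section \<open>Quasi-nilpotent operators\<close>

lemma norm_le_onorm_on:
  assumes "bounded_linear f" "x \<in> M"
  shows "norm (f x) \<le> onorm_on M f * norm x"
proof (cases "x = 0")
  case True
  then show ?thesis using assms by (simp add: linear_simps)
next
  case False
  have "bdd_above ((\<lambda>x. norm (f x) / norm x) ` M)"
    by (rule bdd_aboveI2[where M = "onorm f"]) (rule le_onorm[OF assms(1)])
  then have "norm (f x) / norm x \<le> onorm_on M f"
    unfolding onorm_on_def using assms(2) by (rule cSUP_upper2) simp
  then show ?thesis using False by (simp add: divide_le_eq)
qed

lemma onorm_on_le:
  assumes "M \<noteq> {}" "0 \<le> K" "\<And>x. x \<in> M \<Longrightarrow> norm (f x) \<le> K * norm x"
  shows "onorm_on M f \<le> K"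
  unfolding onorm_on_def
proof (rule cSUP_least[OF assms(1)])
  show "norm (f x) / norm x \<le> K" if "x \<in> M" for x
    using assms(2) assms(3)[OF that] by (cases "x = 0") (auto simp: divide_le_eq)
qed

lemma onorm_on_nonneg:
  assumes "bounded_linear f" "0 \<in> M"
  shows "0 \<le> onorm_on M f"
proof -
  have "bdd_above ((\<lambda>x. norm (f x) / norm x) ` M)"
    by (rule bdd_aboveI2[where M = "onorm f"]) (rule le_onorm[OF assms(1)])
  then show ?thesis
    unfolding onorm_on_def using assms(2) by (rule cSUP_upper2) simp
qed

lemma bounded_linear_funpow:
  fixes f :: "'a::real_normed_vector \<Rightarrow> 'a"
  assumes "bounded_linear f"
  shows "bounded_linear (f ^^ n)"
proof (induction n)
  case 0
  show ?case unfolding funpow.simps id_def by (rule bounded_linear_ident)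
next
  case (Suc n)
  then show ?case using bounded_linear_compose[OF assms] by (simp add: comp_def)
qed

lemma quasi_nilpotent_on_powers_decay:
  assumes T: "bounded_linear T" and "0 \<in> M" and qn: "quasi_nilpotent_on M T"
  obtains N where "0 < N" "\<And>n x. n \<ge> N \<Longrightarrow> x \<in> M \<Longrightarrow> norm ((T ^^ n) x) \<le> (1/2) ^ n * norm x"
proof -
  have "\<forall>\<^sub>F n in sequentially. root n (onorm_on M (T ^^ n)) < 1/2"
    using qn unfolding quasi_nilpotent_on_def by (rule order_tendstoD(2)) simp
  then obtain N where N: "\<And>n. n \<ge> N \<Longrightarrow> root n (onorm_on M (T ^^ n)) < 1/2"
    by (auto simp: eventually_sequentially)
  show thesis
  proof
    fix n x
    assume n: "n \<ge> Suc N" and x: "x \<in> M"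
    have nonneg: "0 \<le> onorm_on M (T ^^ n)"
      by (rule onorm_on_nonneg[OF bounded_linear_funpow[OF T] \<open>0 \<in> M\<close>])
    have "onorm_on M (T ^^ n) = root n (onorm_on M (T ^^ n)) ^ n"
      using n nonneg by simp
    also have "\<dots> \<le> (1/2) ^ n"
      using n nonneg N[of n] by (intro power_mono) auto
    finally have "onorm_on M (T ^^ n) * norm x \<le> (1/2) ^ n * norm x"
      by (rule mult_right_mono) simp
    with norm_le_onorm_on[OF bounded_linear_funpow[OF T] x]
    show "norm ((T ^^ n) x) \<le> (1/2) ^ n * norm x" by (rule order_trans)
  qed simp
qed

text \<open>If \<open>T x = - x\<close>, then all powers of \<open>T\<close> preserve the norm of \<open>x\<close>, against their decay.\<close>

lemma quasi_nilpotent_on_plus_id_injective: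
  assumes T: "bounded_linear T" and M: "0 \<in> M" "x \<in> M" and qn: "quasi_nilpotent_on M T"
    and "T x + x = 0"
  shows "x = 0"
proof -
  interpret bounded_linear T by fact
  obtain N where N: "0 < N"
    "\<And>n x. n \<ge> N \<Longrightarrow> x \<in> M \<Longrightarrow> norm ((T ^^ n) x) \<le> (1/2) ^ n * norm x"
    using quasi_nilpotent_on_powers_decay[OF T M(1) qn] by metis
  have "T x = - x" using \<open>T x + x = 0\<close> by (simp add: eq_neg_iff_add_eq_0)
  then have "(T ^^ n) x = x \<or> (T ^^ n) x = - x" for n
    by (induction n) (auto simp: neg)
  then have "norm ((T ^^ N) x) = norm x" by (metis norm_minus_cancel)
  then have "norm x \<le> (1/2) ^ N * norm x" using N(2)[of N x] M by simp
  moreover have "(1/2::real) ^ N < 1" using \<open>0 < N\<close> by (simp add: power_less_one_iff)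
  ultimately show ?thesis
    using mult_strict_right_mono[of "(1/2) ^ N" 1 "norm x"] by fastforce
qed

text \<open>The preimage is the Neumann series \<open>\<Sum>(- T)\<^sup>n y\<close>.\<close>

lemma quasi_nilpotent_on_plus_id_surjective:
  assumes T: "bounded_linear T" and M: "closed_csubspace M" "T ` M \<subseteq> M" "y \<in> M"
    and qn: "quasi_nilpotent_on M T"
  shows "\<exists>x\<in>M. T x + x = y"
proof -
  interpret bounded_linear T by fact
  have sub: "complex_vector.subspace M" and "closed M"
    using M by (auto simp: closed_csubspace_def)
  define s where "s n = (-1::real) ^ n *\<^sub>R (T ^^ n) y" for n
  obtain N where N: "\<And>n x. n \<ge> N \<Longrightarrow> x \<in> M \<Longrightarrow> norm ((T ^^ n) x) \<le> (1/2) ^ n * norm x"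
    using quasi_nilpotent_on_powers_decay[OF T complex_vector.subspace_0[OF sub] qn] by metis
  have "summable (\<lambda>n. (1/2::real) ^ n * norm y)"
    by (intro summable_mult2 summable_geometric) simp
  then have "summable s"
    by (rule summable_comparison_test') (use N M in \<open>simp add: s_def\<close>)
  have T_s: "T (s n) = - s (Suc n)" for n by (simp add: s_def scaleR)
  have pow_M: "(T ^^ n) y \<in> M" for n
    by (induction n) (use M in auto)
  have "s n \<in> M" for n
    using complex_vector.subspace_scale[OF sub pow_M]
    by (simp add: s_def flip: scaleC_of_real)
  then have "(\<Sum>i<n. s i) \<in> M" for n
    by (intro complex_vector.subspace_sum[OF sub])
  then have "suminf s \<in> M"
    using closed_sequentially[OF \<open>closed M\<close> _ summable_LIMSEQ[OF \<open>summable s\<close>]] by blast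
  moreover have "T (suminf s) + suminf s = y"
  proof -
    have "T (suminf s) = (\<Sum>n. - s (Suc n))"
      by (simp add: suminf[OF \<open>summable s\<close>] T_s)
    also have "\<dots> = - (\<Sum>n. s (Suc n))"
      by (rule suminf_minus) (use \<open>summable s\<close> in \<open>simp add: summable_Suc_iff\<close>)
    also have "(\<Sum>n. s (Suc n)) = suminf s - s 0"
      by (rule suminf_split_head[OF \<open>summable s\<close>])
    finally show ?thesis by (simp add: s_def[of 0])
  qed
  ultimately show ?thesis by blast
qed

text \<open>
  The hypotheses make \<open>(T P)\<^sup>n = T\<^sup>n P\<close> for \<open>n > 0\<close>, so passing from \<open>M\<close> to the
  whole space costs at most the constant factor \<open>\<parallel>P\<parallel>\<close>, which the \<open>n\<close>-th root removes in the limit.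
\<close>

lemma quasi_nilpotent_comp_projection:
  fixes T P :: "'a::complex_banach \<Rightarrow> 'a"
  assumes T: "bounded_linear T" and P: "bounded_linear P" "\<And>x. P x \<in> M" "\<And>x. x \<in> M \<Longrightarrow> P x = x"
    and inv: "T ` M \<subseteq> M" and qn: "quasi_nilpotent_on M T"
  shows "quasi_nilpotent (T \<circ> P)"
proof -
  have "0 \<in> M" using P(2)[of 0] P(1) by (simp add: linear_simps)
  obtain C where C: "0 < C" "\<And>x. norm (P x) \<le> norm x * C"
    using bounded_linear.pos_bounded[OF P(1)] by blast
  define a where "a n = onorm_on M (T ^^ n)" for n
  have a_nonneg: "0 \<le> a n" for n
    unfolding a_def by (rule onorm_on_nonneg[OF bounded_linear_funpow[OF T] \<open>0 \<in> M\<close>])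
  have TP: "bounded_linear (T \<circ> P)"
    using bounded_linear_compose[OF T P(1)] by (simp add: comp_def)
  have pow_M: "(T ^^ n) (P x) \<in> M" for n x
    by (induction n) (use inv P in auto)
  have pow: "((T \<circ> P) ^^ Suc n) x = (T ^^ Suc n) (P x)" for n x
    proof (induction n)
    case (Suc n)
    show ?case using Suc.IH P(3)[OF pow_M[of "Suc n" x]] by (simp only: funpow.simps comp_apply)
  qed simp
  have le: "onorm_on UNIV ((T \<circ> P) ^^ n) \<le> a n * C" if "0 < n" for n
  proof (rule onorm_on_le)
    fix x
    have "norm (((T \<circ> P) ^^ n) x) \<le> a n * norm (P x)"
      using norm_le_onorm_on[OF bounded_linear_funpow[OF T] P(2)] pow[of "n - 1"] \<open>0 < n\<close>
      by (simp add: a_def)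
    also have "\<dots> \<le> a n * (norm x * C)" by (intro mult_left_mono C a_nonneg)
    finally show "norm (((T \<circ> P) ^^ n) x) \<le> a n * C * norm x" by (simp add: ac_simps)
  qed (use a_nonneg C in auto)
  show ?thesis
    unfolding quasi_nilpotent_on_def
  proof (rule tendsto_sandwich)
    show "\<forall>\<^sub>F n in sequentially. 0 \<le> root n (onorm_on UNIV ((T \<circ> P) ^^ n))"
      by (intro always_eventually allI real_root_ge_zero onorm_on_nonneg
          bounded_linear_funpow TP) simp
    show "\<forall>\<^sub>F n in sequentially. root n (onorm_on UNIV ((T \<circ> P) ^^ n)) \<le> root n (a n) * root n C"
      using eventually_gt_at_top[of 0]
      by eventually_elim (use le in \<open>simp flip: real_root_mult\<close>)
    show "(\<lambda>n. root n (a n) * root n C) \<longlonglongrightarrow> 0"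
      using tendsto_mult[OF qn[unfolded quasi_nilpotent_on_def] LIMSEQ_root_const[OF \<open>0 < C\<close>]]
      by (simp add: a_def)
  qed simp
qed

section \<open>Perturbation by the projection\<close>

theorem proposition4p2:
  fixes T :: "'a::complex_banach \<Rightarrow> 'a"
  assumes "T \<in> \<B>" and "pseudo_fredholm T"
  shows "\<exists>S\<in>\<B>. semi_regular (\<lambda>x. T x + S x) \<and> quasi_nilpotent (T \<circ> S) \<and>
    commutator T S = (\<lambda>x. 0)"
proof -
  obtain X1 X2 where
    X1: "closed_csubspace X1" "T ` X1 \<subseteq> X1" and X2: "closed_csubspace X2" "T ` X2 \<subseteq> X2"
    and sum: "{x + y | x y. x \<in> X1 \<and> y \<in> X2} = UNIV" "X1 \<inter> X2 = {0}"
    and sr: "semi_regular_on X1 T" and qn: "quasi_nilpotent_on X2 T"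
    using assms(2) unfolding pseudo_fredholm_def by blast
  obtain P where "P \<in> \<B>" and P_eq: "\<And>x y. P x = y \<longleftrightarrow> y \<in> X2 \<and> x - y \<in> X1"
    using direct_sum_projection[OF X1(1) X2(1) sum] by metis
  have T: "bounded_linear T" and P: "bounded_linear P"
    using \<open>T \<in> \<B>\<close> \<open>P \<in> \<B>\<close> by (auto simp: bounded_operators_def)
  interpret T: bounded_linear T by fact
  interpret P: bounded_linear P by fact
  have zero: "0 \<in> X1" "0 \<in> X2" using sum(2) by auto
  have P_X2: "P x \<in> X2" and P_X1: "x - P x \<in> X1" for x
    using P_eq by blast+
  have P_id: "P x = x" if "x \<in> X2" for x using that zero by (simp add: P_eq)
  have P_0: "P x = 0" if "x \<in> X1" for x using that zero by (simp add: P_eq)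
  have commute: "P (T x) = T (P x)" for x
    unfolding P_eq
  proof
    show "T (P x) \<in> X2" using P_X2 X2 by blast
    have "T (x - P x) \<in> X1" using P_X1 X1 by blast
    then show "T x - T (P x) \<in> X1" by (simp add: T.diff)
  qed
  let ?R = "\<lambda>x. T x + P x"
  have "range ?R = (\<lambda>z. z - P z) -` (T ` X1)"
  proof (intro set_eqI iffI)
    fix z
    assume "z \<in> range ?R"
    then obtain x where "z = T x + P x" by blast
    then have "z - P z = T (x - P x)"
      by (simp add: T.diff P.add commute P_id[OF P_X2])
    then show "z \<in> (\<lambda>z. z - P z) -` (T ` X1)" using P_X1 by auto
  next
    fix z
    assume "z \<in> (\<lambda>z. z - P z) -` (T ` X1)"
    then obtain x1 where x1: "x1 \<in> X1" "z - P z = T x1" by auto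
    obtain x2 where x2: "x2 \<in> X2" "T x2 + x2 = P z"
      using quasi_nilpotent_on_plus_id_surjective[OF T X2 P_X2 qn] by blast
    have "z = T x1 + P z" using x1(2) by (metis diff_add_cancel)
    also have "\<dots> = ?R (x1 + x2)"
      using x1 x2 by (simp add: T.add P.add P_0 P_id add.assoc)
    finally have "z = ?R (x1 + x2)" .
    then show "z \<in> range ?R" by blast
  qed
  moreover have "closed ((\<lambda>z. z - P z) -` (T ` X1))"
    using sr by (intro continuous_closed_vimage continuous_intros P.continuous)
      (auto simp: semi_regular_on_def)
  ultimately have range: "closed (range ?R)" by simp
  have pow: "(?R ^^ n) x = (T ^^ n) x \<and> (T ^^ n) x \<in> X1" if "x \<in> X1" for n x
    by (induction n) (use that X1 in \<open>auto simp: P_0\<close>)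
  have ker: "{x \<in> UNIV. ?R x = 0} \<subseteq> (\<Inter>n. range (?R ^^ n))"
  proof
    fix x
    assume "x \<in> {x \<in> UNIV. ?R x = 0}"
    then have x: "T x + P x = 0" by simp
    \<comment> \<open>Applying \<open>P\<close> to the kernel equation isolates its \<open>X\<^sub>2\<close>-component.\<close>
    have "T (P x) + P x = P (T x + P x)" by (simp add: P.add commute P_id[OF P_X2])
    then have "T (P x) + P x = 0" by (simp add: x P.zero)
    then have "P x = 0"
      using quasi_nilpotent_on_plus_id_injective[OF T zero(2) P_X2 qn] by blast
    then have "x \<in> X1" "T x = 0" using x P_X1[of x] by auto
    then have "x \<in> (T ^^ n) ` X1" for n
      using sr by (auto simp: semi_regular_on_def)
    then show "x \<in> (\<Inter>n. range (?R ^^ n))" using pow by (auto simp: image_iff) metis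
  qed
  have "semi_regular ?R"
    unfolding semi_regular_on_def using range ker by blast
  moreover have "quasi_nilpotent (T \<circ> P)"
    by (rule quasi_nilpotent_comp_projection[OF T P P_X2 P_id X2(2) qn])
  moreover have "commutator T P = (\<lambda>x. 0)"
    by (simp add: commutator_def commute)
  ultimately show ?thesis using \<open>P \<in> \<B>\<close> by blast
qed

end
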